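(* Let $X$ and $Y$ be linear spaces over a field $\mathbb{K}$, let $\gamma_{1,1},\gamma_{1,2},\gamma_{2,1},\gamma_{2,2}\in \mathbb{K}$ be given constants, not all of them zero, and let $f\colon X\times Y\to \mathbb{K}$ be a function with $f(0,0)=0$. Then \[ \gamma_{1,1}f(x_{1},y_{1})+\gamma_{1,2}f(x_{1},y_{2})+\gamma_{2,1}f(x_{2},y_{1})+\gamma_{2,2}f(x_{2},y_{2})=0 \qquad (x_{1}, x_{2}\in X,\ y_{1}, y_{2}\in Y) \] holds if and only if there exist functions $\chi\colon X\to \mathbb{K}$ and $\zeta\colon Y\to \mathbb{K}$ vanishing at zero such that \[ f(x,z)=\chi(x)+\zeta(z) \qquad (x\in X,\ z\in Y) \] and, furthermore, (i) either $\gamma_{1,1}+\gamma_{1,2}=0$ and $\gamma_{2,1}+\gamma_{2,2}=0$, or the function $\chi$ is identically zero; (ii) either $\gamma_{1,1}+\gamma_{2,1}=0$ and $\gamma_{1,2}+\gamma_{2,2}=0$, or the function $\zeta$ is identically zero.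
   Context: In (i) and (ii), "either ... or" is inclusive. *)

theory Defs
  imports Complex_Main
begin

end

theory Submission
  imports Defs
begin

text \<open>
  Put \<open>\<chi> x = f (x, 0)\<close> and \<open>\<zeta> y = f (0, y)\<close>. Setting all but one of the variables to zero shows that
  each row sum of the coefficients annihilates \<open>\<chi>\<close> and each column sum annihilates \<open>\<zeta>\<close>, which, over
  a field, gives the two alternatives. Setting to zero one \<open>x\<close> and one \<open>y\<close> keeps a
  single coefficient in front of \<open>f (x, y)\<close>; by the previous relations this coefficient annihilates the
  mixed difference \<open>f (x, y) - \<chi> x - \<zeta> y\<close> (lemma \<open>coeff_annihilates_mixed_difference\<close>). The four
  coefficients are exchanged by the symmetries of the equation, so any nonzero one of them forces
  \<open>f (x, y) = \<chi> x + \<zeta> y\<close>. Conversely, for such an \<open>f\<close> the left-hand side of the equation regroups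
  into row sums times values of \<open>\<chi>\<close> plus column sums times values of \<open>\<zeta>\<close>, all of
  which vanish under the two alternatives.
\<close>

text \<open>
  The equation at \<open>(x, x0, y, y0)\<close> minus the equations at \<open>(x, x0, y0, y0)\<close> and \<open>(x0, x0, y, y0)\<close>:
  the terms \<open>b * f (x, y0)\<close> and \<open>c * f (x0, y)\<close> cancel, and every other term without the factor \<open>a\<close>
  contains \<open>f (x0, y0) = 0\<close>. Here the arguments are listed in the order \<open>(x1, x2, y1, y2)\<close>.
\<close>
lemma coeff_annihilates_mixed_difference:
  fixes a b c d :: "'k::ring" and f :: "'a \<times> 'b \<Rightarrow> 'k"
  assumes eq: "\<And>x1 x2 y1 y2.
      a * f (x1, y1) + b * f (x1, y2) + c * f (x2, y1) + d * f (x2, y2) = 0"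
    and base: "f (x0, y0) = 0"
  shows "a * (f (x, y) - f (x, y0) - f (x0, y)) = 0"
proof -
  have "a * f (x, y) + b * f (x, y0) + c * f (x0, y) = 0"
    using eq[of x y y0 x0] base by simp
  moreover have "a * f (x, y0) = - (b * f (x, y0))"
    using eq[of x y0 y0 x0] base by (simp add: eq_neg_iff_add_eq_0)
  moreover have "a * f (x0, y) = - (c * f (x0, y))"
    using eq[of x0 y y0 x0] base by (simp add: eq_neg_iff_add_eq_0)
  ultimately show ?thesis
    by (simp add: right_diff_distrib algebra_simps)
qed

theorem proposition10:
  fixes scaleX :: "'k::field \<Rightarrow> 'x::ab_group_add \<Rightarrow> 'x"
    and scaleY :: "'k \<Rightarrow> 'y::ab_group_add \<Rightarrow> 'y"
    and \<gamma>11 \<gamma>12 \<gamma>21 \<gamma>22 :: 'k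
    and f :: "'x \<times> 'y \<Rightarrow> 'k"
  assumes "vector_space scaleX"
    and "vector_space scaleY"
    and "\<not> (\<gamma>11 = 0 \<and> \<gamma>12 = 0 \<and> \<gamma>21 = 0 \<and> \<gamma>22 = 0)"
    and "f (0, 0) = 0"
  shows "(\<forall>x1 x2 y1 y2.
            \<gamma>11 * f (x1, y1) + \<gamma>12 * f (x1, y2) + \<gamma>21 * f (x2, y1) + \<gamma>22 * f (x2, y2) = 0)
     \<longleftrightarrow> (\<exists>(\<chi> :: 'x \<Rightarrow> 'k) (\<zeta> :: 'y \<Rightarrow> 'k).
            \<chi> 0 = 0 \<and> \<zeta> 0 = 0 \<and>
            (\<forall>x z. f (x, z) = \<chi> x + \<zeta> z) \<and>
            ((\<gamma>11 + \<gamma>12 = 0 \<and> \<gamma>21 + \<gamma>22 = 0) \<or> (\<forall>x. \<chi> x = 0)) \<and>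
            ((\<gamma>11 + \<gamma>21 = 0 \<and> \<gamma>12 + \<gamma>22 = 0) \<or> (\<forall>z. \<zeta> z = 0)))"
  (is "?equation \<longleftrightarrow> ?decomposition")
proof
  assume ?equation
  then have eq: "\<gamma>11 * f (x1, y1) + \<gamma>12 * f (x1, y2) + \<gamma>21 * f (x2, y1) + \<gamma>22 * f (x2, y2) = 0"
    for x1 x2 y1 y2
    by blast
  have row1: "(\<gamma>11 + \<gamma>12) * f (x, 0) = 0" for x
    using eq[of x 0 0 0] assms(4) by (simp add: distrib_right)
  have row2: "(\<gamma>21 + \<gamma>22) * f (x, 0) = 0" for x
    using eq[of 0 0 0 x] assms(4) by (simp add: distrib_right)
  have col1: "(\<gamma>11 + \<gamma>21) * f (0, y) = 0" for y
    using eq[of 0 y 0 0] assms(4) by (simp add: distrib_right)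
  have col2: "(\<gamma>12 + \<gamma>22) * f (0, y) = 0" for y
    using eq[of 0 0 y 0] assms(4) by (simp add: distrib_right)
  have sum: "f (x, y) = f (x, 0) + f (0, y)" for x y
  proof -
    let ?D = "f (x, y) - f (x, 0) - f (0, y)"
    \<comment> \<open>Exchanging \<open>x1\<close> with \<open>x2\<close> or \<open>y1\<close> with \<open>y2\<close> moves any coefficient to the first place.\<close>
    have "\<gamma>11 * ?D = 0"
      by (rule coeff_annihilates_mixed_difference[of _ f \<gamma>12 \<gamma>21 \<gamma>22])
        (use eq assms(4) in simp_all)
    moreover have "\<gamma>12 * ?D = 0"
      by (rule coeff_annihilates_mixed_difference[of _ f \<gamma>11 \<gamma>22 \<gamma>21])
        (use eq assms(4) in \<open>simp_all add: ac_simps\<close>)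
    moreover have "\<gamma>21 * ?D = 0"
      by (rule coeff_annihilates_mixed_difference[of _ f \<gamma>22 \<gamma>11 \<gamma>12])
        (use eq assms(4) in \<open>simp_all add: ac_simps\<close>)
    moreover have "\<gamma>22 * ?D = 0"
      by (rule coeff_annihilates_mixed_difference[of _ f \<gamma>21 \<gamma>12 \<gamma>11])
        (use eq assms(4) in \<open>simp_all add: ac_simps\<close>)
    ultimately have "?D = 0"
      using assms(3) by auto
    then show ?thesis
      by (simp add: algebra_simps)
  qed
  show ?decomposition
  proof (intro exI conjI allI)
    show "f (x, z) = f (x, 0) + f (0, z)" for x z
      by (rule sum)
    show "(\<gamma>11 + \<gamma>12 = 0 \<and> \<gamma>21 + \<gamma>22 = 0) \<or> (\<forall>x. f (x, 0) = 0)"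
      using row1 row2 by (metis mult_eq_0_iff)
    show "(\<gamma>11 + \<gamma>21 = 0 \<and> \<gamma>12 + \<gamma>22 = 0) \<or> (\<forall>z. f (0, z) = 0)"
      using col1 col2 by (metis mult_eq_0_iff)
  qed (rule assms(4))+
next
  assume ?decomposition
  then obtain \<chi> \<zeta> where sum: "\<And>x z. f (x, z) = \<chi> x + \<zeta> z"
    and rows: "(\<gamma>11 + \<gamma>12 = 0 \<and> \<gamma>21 + \<gamma>22 = 0) \<or> (\<forall>x. \<chi> x = 0)"
    and cols: "(\<gamma>11 + \<gamma>21 = 0 \<and> \<gamma>12 + \<gamma>22 = 0) \<or> (\<forall>z. \<zeta> z = 0)"
    by blast
  show ?equation
  proof (intro allI)
    fix x1 x2 y1 y2
    have "\<gamma>11 * f (x1, y1) + \<gamma>12 * f (x1, y2) + \<gamma>21 * f (x2, y1) + \<gamma>22 * f (x2, y2)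
        = (\<gamma>11 + \<gamma>12) * \<chi> x1 + (\<gamma>21 + \<gamma>22) * \<chi> x2
          + ((\<gamma>11 + \<gamma>21) * \<zeta> y1 + (\<gamma>12 + \<gamma>22) * \<zeta> y2)"
      by (simp add: sum algebra_simps)
    also have "\<dots> = 0"
      using rows cols by auto
    finally show "\<gamma>11 * f (x1, y1) + \<gamma>12 * f (x1, y2) + \<gamma>21 * f (x2, y1) + \<gamma>22 * f (x2, y2) = 0" .
  qed
qed

end
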